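(* Let $q$ be a power of a prime $p$ (any characteristic, including $p=2$), and let \[ w = a_0(x^5)^* + a_1(x^4y)^* + \dots + a_5(y^5)^* \in V_5 \] with $a_0,\dots,a_5\in\mathbf{F}_q$. Suppose that the binary cubic form \[ \mathrm{Cat}_{2,2}(x, y ; w) = \det \left( \begin{pmatrix} a_1 & a_2 & a_3 \\ a_2 & a_3 & a_4 \\ a_3 & a_4 & a_5 \end{pmatrix} x -\begin{pmatrix} a_0 & a_1 & a_2 \\ a_1 & a_2 & a_3 \\ a_2 & a_3 & a_4 \end{pmatrix} y \right) \] is nonzero (as a polynomial in $x,y$). Then $\widehat{\Phi}(w) = C(w)\,q^{-4}$, where \[ C(w) = - \sum_{[s_0:s_1:s_2]} \varepsilon([s_0x^2 + s_1xy + s_2y^2]), \] the sum being taken over the points $[s_0:s_1:s_2] \in \mathbf{P}^2(\mathbf{F}_q)$ satisfying \[ \begin{pmatrix} s_0 & s_1 & s_2 \end{pmatrix} \begin{pmatrix} a_0 & a_1 & a_2 \\ a_1 & a_2 & a_3 \\ a_2 & a_3 & a_4 \end{pmatrix} \begin{pmatrix} s_0 \\ s_1 \\ s_2 \end{pmatrix} = \begin{pmatrix} s_0 & s_1 & s_2 \end{pmatrix} \begin{pmatrix} a_1 & a_2 & a_3 \\ a_2 & a_3 & a_4 \\ a_3 & a_4 & a_5 \end{pmatrix} \begin{pmatrix} s_0 \\ s_1 \\ s_2 \end{pmatrix} = 0 . \]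
   Context: $\mathbf{F}_q$ is the field with $q$ elements, $q$ a power of the prime $p$. $V_n^*$ denotes the $\mathbf{F}_q$-vector space of binary forms of degree $n$ in $x,y$ (homogeneous polynomials of degree $n$ in $\mathbf{F}_q[x,y]$), and $V_n=(V_n^* )^*$ is its dual space, with basis $(x^n)^*,(x^{n-1}y)^*,\dots,(y^n)^*$ dual to the monomial basis $x^n,x^{n-1}y,\dots,y^n$. $(\cdot,\cdot)\colon V_n\times V_n^*\to\mathbf{F}_q$ is the natural perfect pairing. Fix a nontrivial additive character $\psi\colon\mathbf{F}_q\to\mathbf{C}^\times$. $\mathrm{Disc}(f)$ is the discriminant of a binary form $f$; $\mathrm{Disc}(f)=0$ means that $f$ is singular, i.e. $f$ has a repeated factor (the zero form is counted as singular). The exponential sum of singular binary quintic forms is \[ \widehat{\Phi}(w) = \frac{1}{\# V^*_5} \sum_{\substack{f \in V_5^* \\ \mathrm{Disc}(f) = 0}} \psi((w, f)) \qquad (w \in V_5). \] For a nonzero binary quadratic form $f_2\in V_2^*$, with class $[f_2]$ in the set $\mathbf{P}(V_2^* )$ of nonzero elements of $V_2^*$ modulo $\mathbf{F}_q^\times$, the function $\varepsilon\colon\mathbf{P}(V_2^* )\to\mathbf{C}$ is: $\varepsilon([f_2])=1$ if $f_2$ is split (a product of two non-proportional linear forms over $\mathbf{F}_q$), $\varepsilon([f_2])=0$ if $f_2$ is ramified (a nonzero constant times the square of a linear form over $\mathbf{F}_q$), and $\varepsilon([f_2])=-1$ if $f_2$ is inert (irreducible over $\mathbf{F}_q$). 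*)

theory Defs
  imports
    "HOL-Analysis.Analysis"
    "HOL-Computational_Algebra.Polynomial_Factorial"
    "HOL-Computational_Algebra.Squarefree"
begin

text \<open>
  The polynomial ring \<open>F[x, y]\<close> is \<open>'a poly poly\<close>, read as \<open>F[x][y]\<close>: the coefficient of
  \<open>x\<^sup>i y\<^sup>j\<close> in \<open>f\<close> is \<open>coeff (coeff f j) i\<close>. A finite field with \<open>q\<close> elements is a type
  \<open>'a :: {field, finite}\<close>, with \<open>q = CARD('a)\<close>.
\<close>

definition varX :: "'a::field poly poly" where
  "varX = [:[:0, 1:]:]"

definition varY :: "'a::field poly poly" where
  "varY = [:0, 1:]"

definition const2 :: "'a::field \<Rightarrow> 'a poly poly" where
  "const2 c = [:[:c:]:]"

definition binary_forms :: "nat \<Rightarrow> 'a::field poly poly set" where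
  "binary_forms n = {f. \<forall>i j. coeff (coeff f j) i \<noteq> 0 \<longrightarrow> i + j = n}"

text \<open>
  \<open>dual_monom i j\<close> is the dual basis vector \<open>(x\<^sup>i y\<^sup>j)\<^sup>*\<close>. Elements of \<open>V\<^sub>n\<close> are functionals, so the
  pairing \<open>(w, f)\<close> is the application \<open>w f\<close>; only values on \<open>binary_forms n\<close> matter.
\<close>

definition dual_monom :: "nat \<Rightarrow> nat \<Rightarrow> 'a::field poly poly \<Rightarrow> 'a" where
  "dual_monom i j = (\<lambda>f. coeff (coeff f j) i)"

definition nontrivial_additive_character :: "('a::field \<Rightarrow> complex) \<Rightarrow> bool" where
  "nontrivial_additive_character \<psi> \<longleftrightarrow>
     (\<forall>u. \<psi> u \<noteq> 0) \<and> (\<forall>u v. \<psi> (u + v) = \<psi> u * \<psi> v) \<and> (\<exists>u. \<psi> u \<noteq> 1)"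

text \<open>
  \<open>Disc f = 0\<close> means that \<open>f\<close> has a repeated factor. The form \<open>0\<close> is not \<open>squarefree\<close>, hence it
  is singular. Since finite fields are perfect, it does not matter whether repeated factors are
  taken over the field itself or over its algebraic closure.
\<close>

definition singular_form :: "'a::field poly poly \<Rightarrow> bool" where
  "singular_form f \<longleftrightarrow> \<not> squarefree f"

definition Phi_hat ::
  "('a::{field,finite} \<Rightarrow> complex) \<Rightarrow> ('a poly poly \<Rightarrow> 'a) \<Rightarrow> complex" where
  "Phi_hat \<psi> w =
     1 / of_nat (card (binary_forms 5 :: 'a poly poly set)) *
     (\<Sum>f | f \<in> binary_forms 5 \<and> singular_form f. \<psi> (w f))"

definition split_form :: "'a::field poly poly \<Rightarrow> bool" where
  "split_form f \<longleftrightarrow>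
     (\<exists>l\<in>binary_forms 1 - {0}. \<exists>m\<in>binary_forms 1 - {0}.
        (\<nexists>c. l = const2 c * m) \<and> f = l * m)"

definition ramified_form :: "'a::field poly poly \<Rightarrow> bool" where
  "ramified_form f \<longleftrightarrow> (\<exists>c. \<exists>l\<in>binary_forms 1 - {0}. c \<noteq> 0 \<and> f = const2 c * l ^ 2)"

definition inert_form :: "'a::field poly poly \<Rightarrow> bool" where
  "inert_form f \<longleftrightarrow> irreducible f"

definition epsilon_form :: "'a::field poly poly \<Rightarrow> complex" where
  "epsilon_form f =
     (if split_form f then 1
      else if ramified_form f then 0
      else if inert_form f then - 1
      else undefined)"

text \<open>
  The value at a class \<open>[f]\<close>, given as the set of all nonzero multiples of the nonzero quadratic
  form \<open>f\<close>; \<open>epsilon_form\<close> is constant on such a set.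
\<close>

definition epsilon :: "'a::field poly poly set \<Rightarrow> complex" where
  "epsilon K = the_elem (epsilon_form ` K)"

definition proj_plane :: "('a::field ^ 3) set set" where
  "proj_plane = {v. v \<noteq> 0} // {(u, v). u \<noteq> 0 \<and> (\<exists>c. c \<noteq> 0 \<and> v = c *s u)}"

definition quadratic_form :: "'a::field ^ 3 \<Rightarrow> 'a poly poly" where
  "quadratic_form s =
     const2 (s $ 1) * varX ^ 2 + const2 (s $ 2) * varX * varY + const2 (s $ 3) * varY ^ 2"

definition hankel3 :: "(nat \<Rightarrow> 'a::field) \<Rightarrow> nat \<Rightarrow> 'a ^ 3 ^ 3" where
  "hankel3 a k =
     vector [vector [a k, a (k + 1), a (k + 2)],
             vector [a (k + 1), a (k + 2), a (k + 3)],
             vector [a (k + 2), a (k + 3), a (k + 4)]]"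

definition Cat22 :: "(nat \<Rightarrow> 'a::field) \<Rightarrow> 'a poly poly" where
  "Cat22 a =
     det (\<chi> i j. const2 (hankel3 a 1 $ i $ j) * varX - const2 (hankel3 a 0 $ i $ j) * varY)"

text \<open>
  For a point \<open>P = [s\<^sub>0 : s\<^sub>1 : s\<^sub>2]\<close>, the image \<open>quadratic_form ` P\<close> is the class
  \<open>[s\<^sub>0 x\<^sup>2 + s\<^sub>1 x y + s\<^sub>2 y\<^sup>2]\<close>.
\<close>

definition C_coeff :: "(nat \<Rightarrow> 'a::{field,finite}) \<Rightarrow> complex" where
  "C_coeff a =
     - (\<Sum>P | P \<in> proj_plane \<and>
           (\<forall>s\<in>P. scalar_product s (hankel3 a 0 *v s) = 0 \<and>
                  scalar_product s (hankel3 a 1 *v s) = 0).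
         epsilon (quadratic_form ` P))"

end

theory Submission
  imports Defs
begin

text \<open>
  Let \<open>q\<close> be the number of elements of the field. A nonzero quintic form is singular if and only if
  it is divisible by the square of a linear or of a quadratic form, and Moebius inversion over the
  classes of nonzero forms modulo scalars shows, for every quintic form \<open>f\<close>, that the
  number of classes of linear forms \<open>l\<close> with \<open>l\<^sup>2\<close> dividing \<open>f\<close>, minus the sum of
  \<open>\<epsilon>(g)\<close> over the classes of quadratic forms \<open>g\<close> with \<open>g\<^sup>2\<close> dividing \<open>f\<close>, is 1 if \<open>f\<close> is
  singular and 0 otherwise, because \<open>\<epsilon>\<close> is the Moebius function on quadratic forms
  (\<open>singular_form_indicator\<close>). The only input about \<open>\<epsilon>\<close> is that \<open>1 + \<epsilon>(g)\<close> counts the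
  linear factors of \<open>g\<close> up to scalars (\<open>card_linear_divisors\<close>). If \<open>f \<noteq> 0\<close>, then at most one
  class \<open>[g]\<close> occurs, for reasons of degree, and in this case \<open>l\<^sup>2\<close> divides \<open>f\<close> if and only if \<open>l\<close>
  divides \<open>g\<close>; if none occurs, then there is exactly one class of \<open>l\<close> for singular \<open>f\<close>, since two
  would multiply to a quadratic form, and none otherwise.
  For \<open>f = 0\<close> the identity says that the values of \<open>\<epsilon>\<close> add up to \<open>q\<close>
  (\<open>sum_epsilon_form\<close>).

  The quintic multiples of \<open>l\<^sup>2\<close> form a vector space of dimension 4, those of \<open>g\<^sup>2\<close> one of
  dimension 2, so that the sum of \<open>\<psi>(w(f))\<close> over either space is its cardinality if \<open>w\<close> vanishes on
  it, and 0 otherwise (\<open>character_sum_multiples\<close>). If \<open>w\<close> vanishes on the multiples of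
  \<open>(\<alpha> x + \<beta> y)\<^sup>2\<close>, with \<open>\<alpha>\<close>, \<open>\<beta>\<close> not both zero, then
  \<open>(\<alpha>\<^sup>2, 2 \<alpha> \<beta>, \<beta>\<^sup>2)\<close> is in the kernel of both Hankel matrices,
  so that \<open>Cat\<^sub>2\<^sub>,\<^sub>2\<close> is zero (\<open>Cat22_eq_0\<close>); hence the linear forms contribute nothing. The functional
  \<open>w\<close> vanishes on the multiples of the square of \<open>s\<^sub>0 x\<^sup>2 + s\<^sub>1 x y + s\<^sub>2 y\<^sup>2\<close> if and only if it does so
  on the products of this square with \<open>x\<close> and \<open>y\<close>, and these two values are those of the
  two quadratic forms in \<open>s\<close> that define \<open>C(w)\<close>. This leaves \<open>q\<^sup>-\<^sup>6 q\<^sup>2 C(w)\<close>.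

  All sums run over nonzero forms instead of classes, at the price of a factor \<open>q - 1\<close>. That divisors
  of nonzero forms are forms (\<open>binary_form_factor\<close>) and that linear forms are prime (\<open>linear_form_prime\<close>)
  is the arithmetic of \<open>F[x, y]\<close> behind these steps.
\<close>

section \<open>Binary forms\<close>

lemma binary_formsI: "(\<And>i j. i + j \<noteq> n \<Longrightarrow> coeff (coeff f j) i = 0) \<Longrightarrow> f \<in> binary_forms n"
  unfolding binary_forms_def by blast

lemma coeff_binary_form: "f \<in> binary_forms n \<Longrightarrow> i + j \<noteq> n \<Longrightarrow> coeff (coeff f j) i = 0"
  unfolding binary_forms_def by blast

lemma binary_forms_0 [simp]: "0 \<in> binary_forms n"
  by (rule binary_formsI) simp

lemma binary_forms_add: "f \<in> binary_forms n \<Longrightarrow> g \<in> binary_forms n \<Longrightarrow> f + g \<in> binary_forms n"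
  by (rule binary_formsI) (simp add: coeff_binary_form)

lemma binary_forms_diff: "f \<in> binary_forms n \<Longrightarrow> g \<in> binary_forms n \<Longrightarrow> f - g \<in> binary_forms n"
  by (rule binary_formsI) (simp add: coeff_binary_form)

lemma binary_forms_mult:
  assumes f: "f \<in> binary_forms m" and g: "g \<in> binary_forms n"
  shows "f * g \<in> binary_forms (m + n)"
proof (rule binary_formsI)
  fix i j :: nat assume ij: "i + j \<noteq> m + n"
  have "coeff (coeff f k) l * coeff (coeff g (j - k)) (i - l) = 0" if "k \<le> j" "l \<le> i" for k l
  proof (cases "l + k = m")
    case True
    with ij that have "(i - l) + (j - k) \<noteq> n" by linarith
    with g show ?thesis by (simp add: coeff_binary_form)
  next
    case False
    with f show ?thesis by (simp add: coeff_binary_form)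
  qed
  then show "coeff (coeff (f * g) j) i = 0"
    by (auto simp: coeff_mult coeff_sum intro!: sum.neutral simp del: mult_eq_0_iff)
qed

lemma binary_forms_power: "f \<in> binary_forms m \<Longrightarrow> f ^ k \<in> binary_forms (k * m)"
proof (induction k)
  case 0
  show ?case by (rule binary_formsI) (auto simp: coeff_pCons split: nat.splits)
next
  case (Suc k)
  then show ?case by (auto intro: binary_forms_mult)
qed

lemma binary_forms_const2 [simp]: "const2 c \<in> binary_forms 0"
  by (rule binary_formsI) (auto simp: const2_def coeff_pCons split: nat.splits)

lemma varX_binary_form [simp]: "varX \<in> binary_forms 1"
  by (rule binary_formsI) (auto simp: varX_def coeff_pCons split: nat.splits)

lemma varY_binary_form [simp]: "varY \<in> binary_forms 1"
  by (rule binary_formsI) (auto simp: varY_def coeff_pCons split: nat.splits)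

lemma binary_forms_scale: "f \<in> binary_forms n \<Longrightarrow> const2 c * f \<in> binary_forms n"
  using binary_forms_mult[OF binary_forms_const2] by fastforce

lemma binary_form_degree_unique:
  assumes "f \<in> binary_forms m" "f \<in> binary_forms n" "f \<noteq> 0"
  shows "m = n"
proof -
  from \<open>f \<noteq> 0\<close> have "coeff (coeff f (degree f)) (degree (coeff f (degree f))) \<noteq> 0"
    by simp
  with assms(1,2) show ?thesis
    by (metis coeff_binary_form)
qed

lemma binary_forms_0_eq: "f \<in> binary_forms 0 \<Longrightarrow> \<exists>c. f = const2 c"
proof -
  assume f: "f \<in> binary_forms 0"
  have "f = const2 (coeff (coeff f 0) 0)"
  proof (intro poly_eqI)
    fix j i show "coeff (coeff f j) i = coeff (coeff (const2 (coeff (coeff f 0) 0)) j) i"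
      using coeff_binary_form[OF f, of i j] by (auto simp: const2_def coeff_pCons split: nat.splits)
  qed
  then show ?thesis ..
qed

lemma const2_mult: "const2 (c * d) = const2 c * const2 d"
  by (simp add: const2_def)

lemma const2_eq_iff [simp]: "const2 c = const2 d \<longleftrightarrow> c = d"
  by (simp add: const2_def)

lemma const2_0 [simp]: "const2 0 = 0" and const2_1 [simp]: "const2 1 = 1"
  by (simp_all add: const2_def one_pCons)

lemma const2_eq_0_iff [simp]: "const2 c = 0 \<longleftrightarrow> c = 0"
  by (simp add: const2_def)

lemma const2_inverse: "c \<noteq> 0 \<Longrightarrow> const2 (inverse c) * const2 c = 1"
  by (simp flip: const2_mult)

lemma const2_dvd_1: "c \<noteq> 0 \<Longrightarrow> const2 c dvd 1"
  using const2_inverse[of c] by (metis dvd_triv_right)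

lemma unit_binary_form:
  assumes "f \<in> binary_forms n" "f dvd 1" shows "n = 0"
proof -
  from assms(2) obtain c where f: "f = [:c:]" "c dvd 1" unfolding is_unit_poly_iff by blast
  then obtain d where "f = const2 d" unfolding is_unit_poly_iff const2_def by blast
  then have "f \<in> binary_forms 0" by simp
  moreover have "f \<noteq> 0" using assms(2) by auto
  ultimately show ?thesis using assms(1) binary_form_degree_unique by blast
qed

lemma binary_form_expansion:
  assumes "f \<in> binary_forms n"
  shows "f = (\<Sum>j\<le>n. monom (monom (coeff (coeff f j) (n - j)) (n - j)) j)"
proof (intro poly_eqI)
  fix j i
  show "coeff (coeff f j) i
    = coeff (coeff (\<Sum>j\<le>n. monom (monom (coeff (coeff f j) (n - j)) (n - j)) j) j) i"
    using coeff_binary_form[OF assms, of i j] 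
    by (auto simp: coeff_sum if_distrib [of "\<lambda>p. coeff p _"] sum.delta' cong: if_cong)
qed

section \<open>Divisors of binary forms\<close>

text \<open>The inclusion \<open>F[x] \<rightarrow> F[t][X]\<close> with \<open>x \<mapsto> X\<close>: all coefficients are constant in \<open>t\<close>.\<close>

definition lift_const :: "'a::field poly \<Rightarrow> 'a poly poly" where
  "lift_const = map_poly (\<lambda>c. [:c:])"

text \<open>
  The ring homomorphism \<open>F[x, y] \<rightarrow> F[t][X]\<close> with \<open>x \<mapsto> X\<close> and \<open>y \<mapsto> t X\<close>. The coefficient of
  \<open>X\<^sup>k\<close> in the image of \<open>f\<close> is the dehomogenization of the degree \<open>k\<close> part of \<open>f\<close>, so that \<open>f\<close>
  is a form of degree \<open>n\<close> if and only if its image is \<open>r X\<^sup>n\<close> for some \<open>r \<in> F[t]\<close>.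
\<close>

definition regrade :: "'a::field poly poly \<Rightarrow> 'a poly poly" where
  "regrade f = poly (map_poly lift_const f) [:0, [:0, 1:]:]"

lemma lift_const_0 [simp]: "lift_const 0 = 0"
  by (simp add: lift_const_def)

lemma coeff_lift_const: "coeff (lift_const p) n = [:coeff p n:]"
  by (simp add: lift_const_def coeff_map_poly)

lemma lift_const_pCons: "lift_const (pCons c p) = pCons [:c:] (lift_const p)"
  by (simp add: lift_const_def map_poly_pCons)

lemma lift_const_add: "lift_const (p + q) = lift_const p + lift_const q"
  by (intro poly_eqI) (simp add: coeff_lift_const)

lemma lift_const_smult: "lift_const (smult c p) = smult [:c:] (lift_const p)"
  by (rule poly_eqI) (simp add: coeff_lift_const)

lemma lift_const_mult: "lift_const (p * q) = lift_const p * lift_const q"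
  by (induction p) (simp_all add: lift_const_pCons lift_const_add lift_const_smult)

lemma regrade_pCons: "regrade (pCons c f) = lift_const c + pCons 0 (smult [:0, 1:] (regrade f))"
  by (simp add: regrade_def map_poly_pCons)

lemma regrade_0 [simp]: "regrade 0 = 0"
  by (simp add: regrade_def)

lemma regrade_add: "regrade (f + g) = regrade f + regrade g"
proof -
  have "map_poly lift_const (f + g) = map_poly lift_const f + map_poly lift_const g"
    by (intro poly_eqI) (simp add: coeff_map_poly lift_const_add)
  then show ?thesis by (simp add: regrade_def)
qed

lemma regrade_smult: "regrade (smult c f) = lift_const c * regrade f"
proof -
  have "map_poly lift_const (smult c f) = smult (lift_const c) (map_poly lift_const f)"
    by (intro poly_eqI) (simp add: coeff_map_poly lift_const_mult)
  then show ?thesis by (simp add: regrade_def)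
qed

lemma regrade_mult: "regrade (f * g) = regrade f * regrade g"
  by (induction f) (simp_all add: regrade_pCons regrade_add regrade_smult algebra_simps)

lemma coeff_regrade:
  "coeff (coeff (regrade f) k) j = (if j \<le> k then coeff (coeff f j) (k - j) else 0)"
proof (induction f arbitrary: k j)
  case 0
  then show ?case by simp
next
  case (pCons c f)
  then show ?case
    by (auto simp: regrade_pCons coeff_lift_const coeff_pCons split: nat.splits)
qed

lemma binary_form_iff_regrade:
  "f \<in> binary_forms n \<longleftrightarrow> (\<forall>k. k \<noteq> n \<longrightarrow> coeff (regrade f) k = 0)"
proof
  assume f: "f \<in> binary_forms n"
  show "\<forall>k. k \<noteq> n \<longrightarrow> coeff (regrade f) k = 0"
    using coeff_binary_form[OF f] by (auto intro!: poly_eqI simp: coeff_regrade)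
next
  assume R: "\<forall>k. k \<noteq> n \<longrightarrow> coeff (regrade f) k = 0"
  show "f \<in> binary_forms n"
  proof (rule binary_formsI)
    fix i j :: nat assume "i + j \<noteq> n"
    with R have "coeff (coeff (regrade f) (i + j)) j = 0" by simp
    then show "coeff (coeff f j) i = 0" by (simp add: coeff_regrade)
  qed
qed

text \<open>A factor of a monomial over a domain is a monomial: compare degree and order at 0.\<close>

lemma monomial_factor:
  fixes p q :: "'a::idom poly"
  assumes pq: "p * q = monom c n" and c: "c \<noteq> 0" and k: "k \<noteq> degree p"
  shows "coeff p k = 0"
proof -
  have nz: "p * q \<noteq> 0" using pq c by simp
  then have nz': "p \<noteq> 0" "q \<noteq> 0" by auto
  have le: "order 0 p \<le> degree p" "order 0 q \<le> degree q"
    using nz' by (simp_all add: order_degree)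
  have "order 0 p + order 0 q = n"
    using order_mult[OF nz, of 0] pq c by simp
  moreover have "degree p + degree q = n"
    using degree_mult_eq[OF nz'] pq c by (simp add: degree_monom_eq)
  ultimately have "order 0 p = degree p" using le by linarith
  then have "monom 1 (degree p) dvd p"
    using nz'(1) by (simp add: monom_1_dvd_iff)
  then have "k < degree p \<Longrightarrow> coeff p k = 0" by (simp add: monom_1_dvd_iff')
  then show ?thesis using k by (cases "k < degree p") (auto simp: coeff_eq_0)
qed

lemma binary_form_factor:
  assumes fg: "f * g \<in> binary_forms n" and nz: "f * g \<noteq> 0"
  obtains k l where "f \<in> binary_forms k" "g \<in> binary_forms l" "k + l = n"
proof -
  define c where "c = coeff (regrade (f * g)) n"
  have eq: "regrade f * regrade g = monom c n"
    using fg unfolding binary_form_iff_regrade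
    by (intro poly_eqI) (auto simp: c_def simp flip: regrade_mult)
  have "c \<noteq> 0"
  proof
    assume "c = 0"
    then have "regrade (f * g) = 0" using eq by (simp add: regrade_mult)
    then have "f * g = 0"
      by (intro poly_eqI) (metis coeff_regrade coeff_0 le_add2 add_diff_cancel_right')
    with nz show False by simp
  qed
  then have f: "f \<in> binary_forms (degree (regrade f))" 
    and g: "g \<in> binary_forms (degree (regrade g))"
    unfolding binary_form_iff_regrade
    using monomial_factor[OF eq] monomial_factor[of "regrade g" "regrade f"] eq
    by (auto simp: mult.commute)
  have "degree (regrade f) + degree (regrade g) = n"
    using binary_form_degree_unique[OF binary_forms_mult[OF f g] fg nz] .
  with f g show ?thesis by (rule that)
qed

section \<open>Linear forms\<close>

lemma linear_form_eq:
  "l \<in> binary_forms 1 \<Longrightarrow> l = [:[:0, coeff (coeff l 0) 1:], [:coeff (coeff l 1) 0:]:]"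
  by (intro poly_eqI) (auto simp: coeff_binary_form coeff_pCons numeral_eq_Suc split: nat.splits)

text \<open>The nonzero linear form \<open>\<alpha> x + \<beta> y\<close> divides a form \<open>f\<close> if and only if \<open>f\<close> vanishes at \<open>(\<beta>, -\<alpha>)\<close>.\<close>

lemma linear_form_dvd_iff:
  assumes f: "f \<in> binary_forms n" and l: "l = [:[:0, \<alpha>:], [:\<beta>:]:]" "l \<noteq> 0"
  shows "l dvd f \<longleftrightarrow> poly (poly f [:- \<alpha>:]) \<beta> = 0"
proof
  assume "l dvd f"
  then show "poly (poly f [:- \<alpha>:]) \<beta> = 0" using l(1) by (auto elim!: dvdE)
next
  define c where "c j = coeff (coeff f j) (n - j)" for j
  have poly_f: "poly f z = (\<Sum>j\<le>n. monom (c j) (n - j) * z ^ j)" for z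
    by (subst binary_form_expansion[OF f]) (simp add: poly_sum poly_monom c_def)
  assume "poly (poly f [:- \<alpha>:]) \<beta> = 0"
  then have zero: "(\<Sum>j\<le>n. c j * \<beta> ^ (n - j) * (- \<alpha>) ^ j) = 0"
    by (simp add: poly_f poly_sum poly_monom poly_power)
  show "l dvd f"
  proof (cases "\<beta> = 0")
    case False
    \<comment> \<open>Up to a scalar, \<open>l\<close> is \<open>y - r x\<close>; substituting \<open>y = r x\<close> into \<open>f\<close> gives a multiple of \<open>x\<^sup>n\<close>.\<close>
    define r where "r = - \<alpha> / \<beta>"
    have "(\<Sum>j\<le>n. c j * \<beta> ^ (n - j) * (- \<alpha>) ^ j) = \<beta> ^ n * (\<Sum>j\<le>n. c j * r ^ j)"
      unfolding sum_distrib_left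
    proof (rule sum.cong)
      fix j assume "j \<in> {..n}"
      then have "\<beta> ^ n = \<beta> ^ (n - j) * \<beta> ^ j" by (simp flip: power_add)
      then show "c j * \<beta> ^ (n - j) * (- \<alpha>) ^ j = \<beta> ^ n * (c j * r ^ j)"
        using False by (simp add: r_def power_divide flip: power_mult_distrib)
    qed simp
    with zero False have "(\<Sum>j\<le>n. c j * r ^ j) = 0" by simp
    moreover have "poly f (monom r 1) = monom (\<Sum>j\<le>n. c j * r ^ j) n"
      by (simp add: poly_f monom_power mult_monom flip: monom_sum)
    ultimately have "poly f (monom r 1) = 0" by simp
    then have "[:- monom r 1, 1:] dvd f" by (simp only: poly_eq_0_iff_dvd)
    moreover have "l = const2 \<beta> * [:- monom r 1, 1:]"
      using False by (simp add: l const2_def r_def monom_altdef)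
    ultimately show ?thesis
      by (simp only: mult_unit_dvd_iff' [OF const2_dvd_1[OF False]])
  next
    case True
    \<comment> \<open>Now \<open>l\<close> is a multiple of \<open>x\<close>, and the hypothesis says that \<open>y\<^sup>n\<close> does not occur in \<open>f\<close>.\<close>
    then have \<alpha>: "\<alpha> \<noteq> 0" using l by auto
    have "(\<Sum>j\<le>n. c j * \<beta> ^ (n - j) * (- \<alpha>) ^ j) = (\<Sum>j\<in>{n}. c j * \<beta> ^ (n - j) * (- \<alpha>) ^ j)"
      using True by (intro sum.mono_neutral_right) auto
    with zero \<alpha> have "c n = 0" by simp
    have "[:0, 1:] dvd coeff f j" for j
    proof -
      have "poly (coeff f j) 0 = 0"
        using \<open>c n = 0\<close> coeff_binary_form[OF f, of 0 j] by (auto simp: c_def poly_0_coeff_0)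
      then show ?thesis by (simp add: poly_eq_0_iff_dvd)
    qed
    then have "[:[:0, 1:]:] dvd f" by (simp add: const_poly_dvd_iff)
    moreover have "l = const2 \<alpha> * [:[:0, 1:]:]" using True by (simp add: l const2_def)
    ultimately show ?thesis
      by (simp only: mult_unit_dvd_iff' [OF const2_dvd_1[OF \<alpha>]])
  qed
qed

lemma linear_form_prime:
  assumes "l \<in> binary_forms 1" "l \<noteq> 0" "f \<in> binary_forms m" "g \<in> binary_forms n"
    and "l dvd f * g"
  shows "l dvd f \<or> l dvd g"
  using assms(5) linear_form_dvd_iff[OF _ linear_form_eq[OF assms(1)] assms(2)]
    assms(3,4) binary_forms_mult[OF assms(3,4)]
  by auto

lemma binary_form_dvdE:
  assumes "g dvd f" "f \<in> binary_forms n" "f \<noteq> 0" "g \<in> binary_forms m"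
  obtains h where "f = g * h" "h \<in> binary_forms (n - m)" "m \<le> n"
proof -
  obtain h where h: "f = g * h" using assms(1) by (auto elim: dvdE)
  obtain k l where kl: "g \<in> binary_forms k" "h \<in> binary_forms l" "k + l = n"
    using binary_form_factor[of g h n] assms h by metis
  have "g \<noteq> 0" using h assms by auto
  with kl assms have "k = m" by (metis binary_form_degree_unique)
  with kl have "h \<in> binary_forms (n - m)" "m \<le> n" by auto
  with h show ?thesis by (rule that)
qed

lemma binary_form_dvd_same_degree:
  assumes "g dvd f" "f \<in> binary_forms n" "f \<noteq> 0" "g \<in> binary_forms n"
  obtains c where "c \<noteq> 0" "f = const2 c * g"
proof -
  obtain h where h: "f = g * h" "h \<in> binary_forms 0"
    using binary_form_dvdE[OF assms] by auto
  then obtain c where "h = const2 c" using binary_forms_0_eq by blast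
  with h assms(3) that[of c] show ?thesis by (auto simp: mult.commute)
qed

section \<open>Counting forms over a finite field\<close>

lemma bij_betw_binary_forms:
  "bij_betw (\<lambda>f. \<lambda>j\<in>{..n}. coeff (coeff f j) (n - j)) (binary_forms n :: 'a::field poly poly set)
     ({..n} \<rightarrow>\<^sub>E UNIV)"
proof (rule bij_betw_byWitness[where f' = "\<lambda>c. \<Sum>j\<le>n. monom (monom (c j) (n - j)) j"])
  show "\<forall>f\<in>binary_forms n :: 'a poly poly set.
     (\<Sum>j\<le>n. monom (monom ((\<lambda>j\<in>{..n}. coeff (coeff f j) (n - j)) j) (n - j)) j) = f"
  proof
    fix f :: "'a poly poly" assume "f \<in> binary_forms n"
    then show "(\<Sum>j\<le>n. monom (monom ((\<lambda>j\<in>{..n}. coeff (coeff f j) (n - j)) j) (n - j)) j) = f"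
      using binary_form_expansion[of f n] by simp
  qed
  show "\<forall>c\<in>{..n} \<rightarrow>\<^sub>E (UNIV :: 'a set).
     (\<lambda>j\<in>{..n}. coeff (coeff (\<Sum>j\<le>n. monom (monom (c j) (n - j)) j) j) (n - j)) = c"
    by (auto simp: fun_eq_iff PiE_def extensional_def restrict_def coeff_sum
        if_distrib [of "\<lambda>p. coeff p _"] cong: if_cong)
  show "(\<lambda>f. \<lambda>j\<in>{..n}. coeff (coeff f j) (n - j)) ` (binary_forms n :: 'a poly poly set) \<subseteq> {..n} \<rightarrow>\<^sub>E UNIV"
    by (auto split: if_splits)
  show "(\<lambda>c. \<Sum>j\<le>n. monom (monom (c j) (n - j)) j) ` ({..n} \<rightarrow>\<^sub>E (UNIV :: 'a set)) \<subseteq> binary_forms n"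
    by (auto intro!: binary_formsI sum.neutral simp: coeff_sum)
qed

lemma finite_binary_forms [simp]: "finite (binary_forms n :: 'a::{field,finite} poly poly set)"
  using bij_betw_finite[OF bij_betw_binary_forms[where 'a = 'a], of n] by (simp add: finite_PiE)

lemma card_binary_forms: "card (binary_forms n :: 'a::{field,finite} poly poly set) = CARD('a) ^ (n + 1)"
  using bij_betw_same_card[OF bij_betw_binary_forms[where 'a = 'a], of n] by (simp add: card_PiE)

lemma card_field_gt_1: "CARD('a::{field,finite}) > 1"
proof -
  have "card {0, 1 :: 'a} \<le> CARD('a)" by (rule card_mono) auto
  then show ?thesis by simp
qed

text \<open>The class of \<open>f\<close> modulo nonzero scalars.\<close>

definition scalar_class :: "'a::field poly poly \<Rightarrow> 'a poly poly set" where
  "scalar_class f = (\<lambda>c. const2 c * f) ` (UNIV - {0})"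

lemma card_scalar_class:
  fixes f :: "'a::{field,finite} poly poly"
  assumes "f \<noteq> 0" shows "card (scalar_class f) = CARD('a) - 1"
  unfolding scalar_class_def using assms
  by (subst card_image) (auto simp: inj_on_def card_Diff_singleton)

lemma binary_form_dvd_same_degree_iff:
  assumes "f \<in> binary_forms n" "f \<noteq> 0" "g \<in> binary_forms n"
  shows "g dvd f \<longleftrightarrow> g \<in> scalar_class f"
proof
  assume "g dvd f"
  then obtain c where c: "c \<noteq> 0" "f = const2 c * g"
    by (rule binary_form_dvd_same_degree[OF _ assms])
  then have "g = const2 (inverse c) * f"
    using const2_inverse[of c] by (metis mult.assoc mult_1)
  with c show "g \<in> scalar_class f" by (auto simp: scalar_class_def)
next
  assume "g \<in> scalar_class f"
  then obtain c where c: "c \<noteq> 0" "g = const2 c * f" by (auto simp: scalar_class_def)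
  then show "g dvd f" by (simp add: mult_unit_dvd_iff' const2_dvd_1)
qed

lemma scalar_class_subset:
  assumes "f \<in> binary_forms n" "f \<noteq> 0"
  shows "scalar_class f \<subseteq> binary_forms n - {0}"
  using assms by (auto simp: scalar_class_def binary_forms_scale)

text \<open>The nonzero linear forms dividing \<open>f\<close>, not taken modulo scalars.\<close>

definition linear_divisors :: "'a::field poly poly \<Rightarrow> 'a poly poly set" where
  "linear_divisors f = {l \<in> binary_forms 1 - {0}. l dvd f}"

lemma linear_divisors_product:
  assumes "l \<in> binary_forms 1 - {0}" "m \<in> binary_forms 1 - {0}"
  shows "linear_divisors (l * m) = scalar_class l \<union> scalar_class m"
proof -
  have "k dvd l * m \<longleftrightarrow> k dvd l \<or> k dvd m" if "k \<in> binary_forms 1 - {0}" for k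
    using linear_form_prime[of k l 1 m 1] that assms by auto
  then show ?thesis
    using assms scalar_class_subset[of l 1] scalar_class_subset[of m 1]
    by (auto simp: linear_divisors_def binary_form_dvd_same_degree_iff[of _ 1])
qed

lemma linear_divisors_scale: "c \<noteq> 0 \<Longrightarrow> linear_divisors (const2 c * f) = linear_divisors f"
  by (simp add: linear_divisors_def dvd_mult_unit_iff' const2_dvd_1)

lemma irreducible_quadratic_form:
  assumes g: "g \<in> binary_forms 2" "g \<noteq> 0" and none: "linear_divisors g = {}"
  shows "irreducible g"
proof (rule irreducibleI)
  show "g \<noteq> 0" by fact
  show "\<not> g dvd 1" using unit_binary_form[OF g(1)] by auto
next
  fix a b assume ab: "g = a * b"
  obtain k l where kl: "a \<in> binary_forms k" "b \<in> binary_forms l" "k + l = 2"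
    using binary_form_factor[of a b 2] ab g by auto
  have unit: "h dvd 1" if "h \<in> binary_forms 0" "h \<noteq> 0" for h :: "'a poly poly"
    using that binary_forms_0_eq const2_dvd_1 const2_eq_0_iff by metis
  have nz: "a \<noteq> 0" "b \<noteq> 0" using ab g by auto
  have "k \<noteq> 1"
  proof
    assume "k = 1"
    with kl nz ab have "a \<in> linear_divisors g" by (auto simp: linear_divisors_def)
    with none show False by simp
  qed
  with kl consider "k = 0" | "l = 0" by linarith
  then show "a dvd 1 \<or> b dvd 1" using unit kl nz by cases auto
qed

text \<open>
  Hence \<open>1 + \<epsilon>(g)\<close> is the number of zeros of \<open>g\<close> on the projective line over \<open>F\<close>, and all further
  properties of \<open>\<epsilon>\<close> follow from this one.
\<close>

lemma card_linear_divisors: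
  fixes g :: "'a::{field,finite} poly poly"
  assumes g: "g \<in> binary_forms 2" "g \<noteq> 0"
  shows "of_nat (card (linear_divisors g)) = (of_nat CARD('a) - 1) * (1 + epsilon_form g)"
proof -
  have q: "of_nat (CARD('a) - 1) = (of_nat CARD('a) - 1 :: complex)"
    using card_field_gt_1[where 'a = 'a] by (simp add: of_nat_diff)
  show ?thesis
  proof (cases "split_form g")
    case True
    then obtain l m where l: "l \<in> binary_forms 1 - {0}" and m: "m \<in> binary_forms 1 - {0}"
      and ne: "\<nexists>c. l = const2 c * m" and lm: "g = l * m"
      unfolding split_form_def by blast
    have "scalar_class l \<inter> scalar_class m = {}"
    proof (rule ccontr)
      assume "scalar_class l \<inter> scalar_class m \<noteq> {}"
      then obtain c d where "c \<noteq> 0" "const2 c * l = const2 d * m"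
        unfolding scalar_class_def by blast
      then have "l = const2 (inverse c * d) * m"
        using const2_inverse[of c] by (metis const2_mult mult.assoc mult_1)
      with ne show False by blast
    qed
    moreover have "finite (scalar_class l)" "finite (scalar_class m)"
      by (simp_all add: scalar_class_def)
    ultimately have "card (linear_divisors g) = 2 * (CARD('a) - 1)"
      using l m by (simp add: lm linear_divisors_product card_Un_disjoint card_scalar_class)
    with True show ?thesis by (simp add: epsilon_form_def q)
  next
    case not_split: False
    show ?thesis
    proof (cases "ramified_form g")
      case True
      then obtain c l where c: "c \<noteq> 0" "l \<in> binary_forms 1 - {0}" "g = const2 c * l ^ 2"
        unfolding ramified_form_def by blast
      then have "linear_divisors g = scalar_class l"
        by (simp add: linear_divisors_scale power2_eq_square linear_divisors_product)
      with c have "card (linear_divisors g) = CARD('a) - 1"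
        by (simp add: card_scalar_class)
      with not_split True show ?thesis by (simp add: epsilon_form_def q)
    next
      case False
      have none: "linear_divisors g = {}"
      proof (rule ccontr)
        assume "linear_divisors g \<noteq> {}"
        then obtain l where l: "l \<in> binary_forms 1 - {0}" "l dvd g"
          by (auto simp: linear_divisors_def)
        then obtain m where m: "g = m * l" "m \<in> binary_forms 1"
          using binary_form_dvdE[of l g 2 1] g by (auto simp: mult.commute)
        with g have m0: "m \<in> binary_forms 1 - {0}" by auto
        show False
        proof (cases "\<exists>c. m = const2 c * l")
          case True
          then obtain c where c: "m = const2 c * l" ..
          then have "c \<noteq> 0" using m0 by auto
          with l m c have "ramified_form g"
            by (auto simp: ramified_form_def power2_eq_square mult.assoc)
          with False show False by simp
        next
          case False
          with l m m0 have "split_form g" unfolding split_form_def by blast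
          with not_split show False by simp
        qed
      qed
      then have "irreducible g" using irreducible_quadratic_form g by blast
      with none not_split False show ?thesis by (simp add: epsilon_form_def inert_form_def)
    qed
  qed
qed

lemma epsilon_form_scale:
  fixes g :: "'a::{field,finite} poly poly"
  assumes "g \<in> binary_forms 2" "g \<noteq> 0" "c \<noteq> 0"
  shows "epsilon_form (const2 c * g) = epsilon_form g"
proof -
  have "of_nat CARD('a) - 1 \<noteq> (0 :: complex)"
    using card_field_gt_1[where 'a = 'a] by simp
  with card_linear_divisors[of "const2 c * g"] card_linear_divisors[of g]
  show ?thesis using assms by (simp add: binary_forms_scale linear_divisors_scale)
qed

section \<open>Detecting singular quintic forms\<close>

lemma card_multiples:
  fixes l :: "'a::{field,finite} poly poly"
  assumes l: "l \<in> binary_forms 1 - {0}"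
  shows "card {g \<in> binary_forms 2 - {0}. l dvd g} = CARD('a) ^ 2 - 1"
proof -
  have "{g \<in> binary_forms 2 - {0}. l dvd g} = (\<lambda>m. l * m) ` (binary_forms 1 - {0})" (is "?A = ?B")
  proof (intro equalityI subsetI)
    fix g assume "g \<in> ?A"
    then have g: "l dvd g" "g \<in> binary_forms 2" "g \<noteq> 0" by auto
    then obtain m where m: "g = l * m" "m \<in> binary_forms (2 - 1)"
      by (rule binary_form_dvdE[of l g 2 1]) (use l in auto)
    with g(3) have "m \<in> binary_forms 1 - {0}" by auto
    with m(1) show "g \<in> ?B" by blast
  next
    fix g assume "g \<in> ?B"
    then obtain m where "g = l * m" "m \<in> binary_forms 1 - {0}" by blast
    with l binary_forms_mult[of l 1 m 1] show "g \<in> ?A"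
      by (simp flip: one_add_one)
  qed
  moreover have "inj_on (\<lambda>m. l * m) (binary_forms 1 - {0})"
    using l by (auto simp: inj_on_def)
  ultimately show ?thesis
    by (simp add: card_image card_Diff_singleton card_binary_forms numeral_eq_Suc)
qed

text \<open>
  Double counting of pairs of a quadratic form and a zero. Up to the factor \<open>q - 1\<close>, the value
  \<open>q\<close> is the coefficient of \<open>T\<^sup>2\<close> in \<open>(1 - T)(1 - q T)\<close>, the inverse of the zeta function of the
  projective line.
\<close>

lemma sum_epsilon_form:
  fixes Q :: complex
  defines "Q \<equiv> of_nat CARD('a::{field,finite})"
  shows "(\<Sum>g\<in>binary_forms 2 - {0 :: 'a poly poly}. epsilon_form g) = Q * (Q - 1)"
proof -
  let ?L = "binary_forms 1 - {0 :: 'a poly poly}" and ?G = "binary_forms 2 - {0 :: 'a poly poly}"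
  have ge: "CARD('a) ^ n \<ge> 1" for n
    using card_field_gt_1[where 'a = 'a] by (simp add: Suc_leI)
  have Q1: "Q - 1 \<noteq> 0" using card_field_gt_1[where 'a = 'a] by (simp add: Q_def)
  have cardL: "of_nat (card ?L) = Q ^ 2 - 1" and cardG: "of_nat (card ?G) = Q ^ 3 - 1"
    using ge[of 2] ge[of 3]
    by (simp_all add: card_Diff_singleton card_binary_forms of_nat_diff Q_def numeral_eq_Suc)
  have "(Q - 1) * (\<Sum>g\<in>?G. 1 + epsilon_form g) = (\<Sum>g\<in>?G. of_nat (card (linear_divisors g)))"
    unfolding sum_distrib_left Q_def
    by (intro sum.cong refl) (auto simp: card_linear_divisors)
  also have "\<dots> = (\<Sum>g\<in>?G. \<Sum>l\<in>?L. of_bool (l dvd g))"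
    by (simp add: linear_divisors_def sum_of_bool_eq Int_def conj_commute)
  also have "\<dots> = (\<Sum>l\<in>?L. \<Sum>g\<in>?G. of_bool (l dvd g))"
    by (rule sum.swap)
  also have "\<dots> = (\<Sum>l\<in>?L. of_nat (card {g \<in> ?G. l dvd g}))"
    by (simp add: sum_of_bool_eq Int_def)
  also have "\<dots> = (\<Sum>l\<in>?L. Q ^ 2 - 1)"
    using ge[of 2] by (intro sum.cong refl) (subst card_multiples, auto simp: of_nat_diff Q_def)
  also have "\<dots> = (Q ^ 2 - 1) * (Q ^ 2 - 1)"
    using cardL by simp
  also have "\<dots> = (Q - 1) * ((Q + 1) * (Q ^ 2 - 1))"
    by (simp add: algebra_simps power2_eq_square)
  finally have "(\<Sum>g\<in>?G. 1 + epsilon_form g) = (Q + 1) * (Q ^ 2 - 1)"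
    using Q1 mult_left_cancel by blast
  moreover have "(\<Sum>g\<in>?G. 1 + epsilon_form g) = (Q ^ 3 - 1) + (\<Sum>g\<in>?G. epsilon_form g)"
    unfolding sum.distrib sum_constant using cardG by simp
  ultimately have "(\<Sum>g\<in>?G. epsilon_form g) = (Q + 1) * (Q ^ 2 - 1) - (Q ^ 3 - 1)"
    by (simp only: eq_diff_eq add.commute)
  then show ?thesis by (simp add: algebra_simps power2_eq_square power3_eq_cube)
qed

text \<open>A case of unique factorization that follows from primality of the linear form \<open>l\<close> alone.\<close>

lemma square_linear_form_cancel:
  assumes l: "l \<in> binary_forms 1 - {0}" and x: "x \<in> binary_forms m" "\<not> l dvd x"
    and h: "h \<in> binary_forms n" "h \<noteq> 0" and dvd: "l ^ 2 dvd x ^ 2 * h"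
  shows "l ^ 2 dvd h"
proof -
  have cancel: "l dvd k" if "k \<in> binary_forms j" "l dvd x ^ 2 * k" for k j
  proof -
    have "l dvd x * (x * k)" using that by (simp add: power2_eq_square mult.assoc)
    then have "l dvd x * k"
      using linear_form_prime[of l x m "x * k" "m + j"] l x that binary_forms_mult by auto
    then show ?thesis
      using linear_form_prime[of l x m k j] l x that by auto
  qed
  have "l dvd x ^ 2 * h" using dvd by (metis dvd_mult_left power2_eq_square)
  with h have "l dvd h" by (blast intro: cancel)
  then obtain k where k: "h = l * k" "k \<in> binary_forms (n - 1)"
    using binary_form_dvdE[of l h n 1] h l by auto
  have "l * l dvd l * (x ^ 2 * k)" using dvd by (simp add: k power2_eq_square mult_ac)
  then have "l dvd x ^ 2 * k" using l by simp
  then have "l dvd k" using k by (blast intro: cancel)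
  then show ?thesis by (simp add: k power2_eq_square)
qed

lemma square_linear_form_not_dvd_linear:
  assumes "l \<in> binary_forms 1" "h \<in> binary_forms 1" "h \<noteq> 0"
  shows "\<not> l ^ 2 dvd h"
proof
  assume "l ^ 2 dvd h"
  moreover have "l ^ 2 \<in> binary_forms 2" using binary_forms_power[OF assms(1), of 2] by simp
  ultimately show False using assms by (auto elim: binary_form_dvdE[of "l ^ 2" h 1 2])
qed

lemma square_quadratic_form_dvdE:
  assumes "g ^ 2 dvd f" "f \<in> binary_forms 5 - {0}" "g \<in> binary_forms 2"
  obtains h where "f = g ^ 2 * h" "h \<in> binary_forms 1 - {0}"
proof -
  obtain h where "f = g ^ 2 * h" "h \<in> binary_forms (5 - 4)"
    using binary_form_dvdE[of "g ^ 2" f 5 4] assms binary_forms_power[of g 2 2] by auto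
  with assms(2) that show ?thesis by auto
qed

lemma linear_divisors_square_divisor:
  assumes f: "f \<in> binary_forms 5 - {0}" and g: "g \<in> binary_forms 2 - {0}" "g ^ 2 dvd f"
  shows "linear_divisors g = {l \<in> binary_forms 1 - {0}. l ^ 2 dvd f}"
proof -
  obtain h where h: "f = g ^ 2 * h" "h \<in> binary_forms 1 - {0}"
    using square_quadratic_form_dvdE[OF g(2) f] g(1) by auto
  have "l dvd g \<longleftrightarrow> l ^ 2 dvd f" if l: "l \<in> binary_forms 1 - {0}" for l
  proof
    assume "l dvd g"
    then show "l ^ 2 dvd f" using g(2) by (meson dvd_power_same dvd_trans)
  next
    assume "l ^ 2 dvd f"
    then show "l dvd g"
      using square_linear_form_cancel[OF l, of g 2 h 1] square_linear_form_not_dvd_linear[of l h]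
        g h l by auto
  qed
  then show ?thesis by (auto simp: linear_divisors_def)
qed

text \<open>
  By degree, a nonzero quintic form is divisible by the square of at most one quadratic form, up
  to scalars.
\<close>

lemma square_divisor_unique:
  assumes f: "f \<in> binary_forms 5 - {0}"
    and g: "g \<in> binary_forms 2 - {0}" "g ^ 2 dvd f"
    and h: "h \<in> binary_forms 2 - {0}" "h ^ 2 dvd f"
  shows "h \<in> scalar_class g"
proof -
  obtain a where a: "f = g ^ 2 * a" "a \<in> binary_forms 1 - {0}"
    using square_quadratic_form_dvdE[OF g(2) f] g(1) by auto
  obtain b where b: "f = h ^ 2 * b" "b \<in> binary_forms 1 - {0}"
    using square_quadratic_form_dvdE[OF h(2) f] h(1) by auto
  have same: "linear_divisors g = linear_divisors h"
    using linear_divisors_square_divisor[OF f] g h by auto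
  have "h dvd g"
  proof (cases "linear_divisors h = {}")
    case False
    \<comment> \<open>A common linear factor \<open>l\<close> can be cancelled, and the cofactors are linear.\<close>
    then obtain l where l: "l \<in> binary_forms 1 - {0}" "l dvd g" "l dvd h"
      using same by (auto simp: linear_divisors_def)
    obtain g' where g': "g = l * g'" "g' \<in> binary_forms 1"
      using binary_form_dvdE[of l g 2 1] g l by auto
    obtain h' where h': "h = l * h'" "h' \<in> binary_forms 1"
      using binary_form_dvdE[of l h 2 1] h l by auto
    have "l ^ 2 * (h' ^ 2 * b) = l ^ 2 * (g' ^ 2 * a)"
      using a(1) b(1) by (simp add: g' h' power_mult_distrib mult_ac)
    then have "g' ^ 2 * a = h' ^ 2 * b" using l by simp
    then have "h' ^ 2 dvd g' ^ 2 * a" by simp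
    moreover have "h' \<in> binary_forms 1 - {0}" using h h' by auto
    ultimately have "h' dvd g'"
      using square_linear_form_cancel[of h' g' 1 a 1] square_linear_form_not_dvd_linear[of h' a]
        a g' by auto
    then show ?thesis by (simp add: g' h')
  next
    case True
    \<comment> \<open>The linear cofactor \<open>b\<close> does not divide \<open>g\<close>, so it is proportional to \<open>a\<close>.\<close>
    have "\<not> b dvd g" using b True same by (auto simp: linear_divisors_def)
    moreover have "b dvd g * (g * a)"
      using a(1) b(1) by (metis dvd_triv_right mult.assoc power2_eq_square)
    ultimately have "b dvd a"
      using linear_form_prime[of b g 2 "g * a" "2 + 1"] linear_form_prime[of b g 2 a 1]
        a(2) b(2) g(1) binary_forms_mult[of g 2 a 1] by blast
    then obtain c where "a = const2 c * b"
      using binary_form_dvd_same_degree[of b a 1] a b by auto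
    with a(1) b(1) have "h ^ 2 * b = (const2 c * g ^ 2) * b" by (metis mult.assoc mult.commute)
    then have eq: "h ^ 2 = const2 c * g ^ 2" using b(2) by (metis DiffD2 mult_right_cancel singletonI)
    \<comment> \<open>Comparing leading coefficients shows that \<open>c\<close> is a square.\<close>
    define lc :: "'a poly poly \<Rightarrow> 'a" where "lc p = lead_coeff (lead_coeff p)" for p
    define r where "r = lc h / lc g"
    have lc_mult: "lc (p * q) = lc p * lc q" for p q by (simp add: lc_def lead_coeff_mult)
    have "lc (const2 c) = c" by (simp add: lc_def const2_def)
    with eq have "lc h ^ 2 = c * lc g ^ 2" by (metis lc_mult power2_eq_square)
    moreover have "lc g \<noteq> 0" using g by (simp add: lc_def)
    ultimately have "c = r ^ 2" by (simp add: r_def field_simps)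
    with eq have "h ^ 2 = (const2 r * g) ^ 2"
      by (simp add: power2_eq_square const2_mult mult_ac)
    then have "h = const2 r * g \<or> h = - (const2 r * g)"
      by (simp only: power2_eq_iff)
    then have "g dvd h" by auto
    then obtain d where "d \<noteq> 0" "h = const2 d * g"
      using binary_form_dvd_same_degree[of g h 2] g h by auto
    then show ?thesis by (simp add: mult_unit_dvd_iff' const2_dvd_1)
  qed
  then show ?thesis
    using binary_form_dvd_same_degree_iff[of g 2 h] g h by auto
qed

text \<open>
  Moebius inversion for quintic forms (including zero), with all sums over nonzero forms
  rather than over their classes, hence the factor \<open>q - 1\<close>.
\<close>

lemma singular_form_indicator:
  fixes f :: "'a::{field,finite} poly poly" and Q :: complex
  assumes f: "f \<in> binary_forms 5"
  defines "Q \<equiv> of_nat CARD('a)"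
  shows "(Q - 1) * of_bool (singular_form f) =
    of_nat (card {l \<in> binary_forms 1 - {0}. l ^ 2 dvd f})
    - (\<Sum>g | g \<in> binary_forms 2 - {0} \<and> g ^ 2 dvd f. epsilon_form g)"
proof (cases "f = 0")
  case True
  have "singular_form f"
    unfolding singular_form_def True by (rule not_squarefreeI[of 0]) simp_all
  moreover have "of_nat (card (binary_forms 1 - {0 :: 'a poly poly})) = Q ^ 2 - 1"
    by (simp add: card_Diff_singleton card_binary_forms of_nat_diff Q_def Suc_leI power2_eq_square)
  moreover have "{l \<in> binary_forms 1 - {0 :: 'a poly poly}. l ^ 2 dvd 0} = binary_forms 1 - {0}"
    by auto
  moreover have "{g. g \<in> binary_forms 2 - {0 :: 'a poly poly} \<and> g ^ 2 dvd 0} = binary_forms 2 - {0}"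
    by auto
  ultimately show ?thesis
    using sum_epsilon_form[where 'a = 'a]
    by (simp only: True Q_def) (simp add: algebra_simps power2_eq_square)
next
  case False
  with f have f: "f \<in> binary_forms 5 - {0}" by simp
  have card_class: "of_nat (card (scalar_class x)) = Q - 1" if "x \<noteq> 0" for x :: "'a poly poly"
    using that card_field_gt_1[where 'a = 'a] by (simp add: card_scalar_class of_nat_diff Q_def)
  show ?thesis
  proof (cases "\<exists>g\<in>binary_forms 2 - {0}. g ^ 2 dvd f")
    case True
    then obtain g where g: "g \<in> binary_forms 2 - {0}" "g ^ 2 dvd f" by blast
    have square_divisors: "{h. h \<in> binary_forms 2 - {0} \<and> h ^ 2 dvd f} = scalar_class g"
    proof (intro equalityI subsetI)
      fix h assume "h \<in> {h. h \<in> binary_forms 2 - {0} \<and> h ^ 2 dvd f}"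
      then show "h \<in> scalar_class g" using square_divisor_unique[OF f g] by blast
    next
      fix h assume h: "h \<in> scalar_class g"
      with g have h': "h \<in> binary_forms 2 - {0}" using scalar_class_subset by blast
      with h g have "h dvd g" using binary_form_dvd_same_degree_iff[of g 2 h] by simp
      with g h' show "h \<in> {h. h \<in> binary_forms 2 - {0} \<and> h ^ 2 dvd f}"
        by (auto intro: dvd_trans dvd_power_same)
    qed
    have "epsilon_form h = epsilon_form g" if h: "h \<in> scalar_class g" for h
    proof -
      obtain c where "c \<noteq> 0" "h = const2 c * g" using h by (auto simp: scalar_class_def)
      with g show ?thesis by (simp add: epsilon_form_scale)
    qed
    then have "(\<Sum>h\<in>scalar_class g. epsilon_form h) = (\<Sum>h\<in>scalar_class g. epsilon_form g)"
      by (rule sum.cong[OF refl])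
    then have sum: "(\<Sum>h\<in>scalar_class g. epsilon_form h) = (Q - 1) * epsilon_form g"
      using g card_class[of g] by simp
    have divisors: "of_nat (card {l \<in> binary_forms 1 - {0}. l ^ 2 dvd f})
        = (Q - 1) * (1 + epsilon_form g)"
      using linear_divisors_square_divisor[OF f g] g card_linear_divisors[of g]
      by (simp add: Q_def)
    have "\<not> g dvd 1" using unit_binary_form[of g 2] g(1) by force
    then have "singular_form f"
      unfolding singular_form_def by (rule not_squarefreeI[OF g(2)])
    then show ?thesis unfolding square_divisors sum divisors by (simp add: algebra_simps)
  next
    case no_quadratic: False
    then have "{g. g \<in> binary_forms 2 - {0} \<and> g ^ 2 dvd f} = {}" by blast
    then have sum: "(\<Sum>g | g \<in> binary_forms 2 - {0} \<and> g ^ 2 dvd f. epsilon_form g) = 0"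
      by (simp only: sum.empty)
    show ?thesis
    proof (cases "singular_form f")
      case False
      have "\<not> l ^ 2 dvd f" if "l \<in> binary_forms 1 - {0}" for l
      proof
        assume "l ^ 2 dvd f"
        with False have "l dvd 1" by (simp add: singular_form_def squarefree_def)
        with that unit_binary_form[of l 1] show False by simp
      qed
      then have "{l \<in> binary_forms 1 - {0}. l ^ 2 dvd f} = {}" by blast
      with False sum show ?thesis by simp
    next
      case True
      then obtain x where x: "x ^ 2 dvd f" "\<not> x dvd 1"
        by (auto simp: singular_form_def squarefree_def)
      obtain y where y: "f = x ^ 2 * y" using x(1) by (auto elim: dvdE)
      then obtain k where k: "x \<in> binary_forms k"
        using binary_form_factor[of x "x * y" 5] f
        by (auto simp: power2_eq_square mult.assoc)
      obtain h where h: "f = x ^ 2 * h" "h \<in> binary_forms (5 - 2 * k)" "2 * k \<le> 5"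
        using binary_form_dvdE[of "x ^ 2" f 5 "2 * k"] x(1) f binary_forms_power[OF k, of 2] by auto
      have x0: "x \<noteq> 0" and h0: "h \<noteq> 0" using f h by auto
      have "k \<noteq> 0"
        using x(2) x0 k binary_forms_0_eq const2_dvd_1 const2_eq_0_iff by metis
      moreover have "k \<noteq> 2" using no_quadratic x(1) x0 k by auto
      ultimately have "k = 1" using h(3) by linarith
      with k h x0 have xL: "x \<in> binary_forms 1 - {0}" and h3: "h \<in> binary_forms 3" by simp_all
      have "l ^ 2 dvd f \<longleftrightarrow> l dvd x" if l: "l \<in> binary_forms 1 - {0}" for l
      proof
        assume "l dvd x"
        then show "l ^ 2 dvd f" using x(1) by (meson dvd_power_same dvd_trans)
      next
        assume lf: "l ^ 2 dvd f"
        show "l dvd x"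
        proof (rule ccontr)
          assume "\<not> l dvd x"
          then have "l ^ 2 dvd h"
            using square_linear_form_cancel[OF l, of x 1 h 3] xL h3 h0 lf h(1) by auto
          then have "(x * l) ^ 2 dvd f" by (simp add: h(1) power_mult_distrib)
          \<comment> \<open>Two independent linear forms would give the excluded quadratic form.\<close>
          moreover have "x * l \<in> binary_forms 2 - {0}"
            using binary_forms_mult[of x 1 l 1] xL l by (simp flip: one_add_one)
          ultimately show False using no_quadratic by blast
        qed
      qed
      moreover have "scalar_class x \<subseteq> binary_forms 1 - {0}"
        using scalar_class_subset xL by blast
      ultimately have "{l \<in> binary_forms 1 - {0}. l ^ 2 dvd f} = scalar_class x"
        using binary_form_dvd_same_degree_iff[of x 1] xL by auto
      with True sum x0 card_class show ?thesis by simp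
    qed
  qed
qed

section \<open>Character sums\<close>

lemma character_zero: "nontrivial_additive_character \<psi> \<Longrightarrow> \<psi> 0 = 1"
  unfolding nontrivial_additive_character_def
  by (metis add_0 mult_cancel_right1)

lemma character_sum_binary_forms:
  fixes \<psi> :: "'a::{field,finite} \<Rightarrow> complex"
  assumes \<psi>: "nontrivial_additive_character \<psi>"
    and add: "\<And>f g. T (f + g) = T f + T g" and scale: "\<And>c f. T (const2 c * f) = c * T f"
  shows "(\<Sum>f\<in>binary_forms n. \<psi> (T f)) =
    (if \<forall>f\<in>binary_forms n. T f = 0 then of_nat CARD('a) ^ (n + 1) else 0)"
proof (cases "\<forall>f\<in>binary_forms n. T f = 0")
  case True
  then show ?thesis
    by (simp add: character_zero[OF \<psi>] card_binary_forms)
next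
  case False
  then obtain f where f: "f \<in> binary_forms n" "T f \<noteq> 0" by blast
  obtain u where u: "\<psi> u \<noteq> 1" using \<psi> unfolding nontrivial_additive_character_def by blast
  \<comment> \<open>Translation by \<open>g\<close> multiplies the sum by \<open>\<psi>(u) \<noteq> 1\<close>.\<close>
  define g where "g = const2 (u / T f) * f"
  have g: "g \<in> binary_forms n" "T g = u"
    using f by (simp_all add: g_def binary_forms_scale scale)
  have "(\<Sum>h\<in>binary_forms n. \<psi> (T h)) = (\<Sum>h\<in>binary_forms n. \<psi> (T (g + h)))"
    using g(1) by (intro sum.reindex_bij_witness[of _ "\<lambda>h. g + h" "\<lambda>h. h - g"])
      (auto simp: binary_forms_add binary_forms_diff)
  also have "\<dots> = \<psi> u * (\<Sum>h\<in>binary_forms n. \<psi> (T h))"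
    using \<psi> by (simp add: add g(2) sum_distrib_left nontrivial_additive_character_def)
  finally have "(\<Sum>h\<in>binary_forms n. \<psi> (T h)) = 0" using u by simp
  with False show ?thesis by simp
qed

text \<open>The same sum over the forms of degree \<open>m + n\<close> that are divisible by a fixed nonzero form of degree \<open>m\<close>.\<close>

lemma character_sum_multiples:
  fixes \<psi> :: "'a::{field,finite} \<Rightarrow> complex"
  assumes \<psi>: "nontrivial_additive_character \<psi>"
    and add: "\<And>f g. T (f + g) = T f + T g" and scale: "\<And>c f. T (const2 c * f) = c * T f"
    and d: "d \<in> binary_forms m" "d \<noteq> 0"
  shows "(\<Sum>f | f \<in> binary_forms (m + n) \<and> d dvd f. \<psi> (T f)) =
    (if \<forall>h\<in>binary_forms n. T (d * h) = 0 then of_nat CARD('a) ^ (n + 1) else 0)"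
proof -
  have "{f. f \<in> binary_forms (m + n) \<and> d dvd f} = (\<lambda>h. d * h) ` binary_forms n"
  proof (intro equalityI subsetI)
    fix f assume f: "f \<in> {f. f \<in> binary_forms (m + n) \<and> d dvd f}"
    show "f \<in> (\<lambda>h. d * h) ` binary_forms n"
    proof (cases "f = 0")
      case True
      then show ?thesis by (auto intro: image_eqI[of _ _ 0])
    next
      case False
      then show ?thesis using binary_form_dvdE[of d f "m + n" m] f d by auto
    qed
  next
    fix f assume "f \<in> (\<lambda>h. d * h) ` binary_forms n"
    then show "f \<in> {f. f \<in> binary_forms (m + n) \<and> d dvd f}"
      using binary_forms_mult d by auto
  qed
  moreover have "inj_on (\<lambda>h. d * h) (binary_forms n)"
    using d by (auto simp: inj_on_def)
  ultimately have "(\<Sum>f | f \<in> binary_forms (m + n) \<and> d dvd f. \<psi> (T f)) =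
      (\<Sum>h\<in>binary_forms n. \<psi> (T (d * h)))"
    by (simp add: sum.reindex)
  also have "\<dots> = (if \<forall>h\<in>binary_forms n. T (d * h) = 0 then of_nat CARD('a) ^ (n + 1) else 0)"
    by (rule character_sum_binary_forms[OF \<psi>])
      (simp_all add: add distrib_left mult.left_commute[of d] scale)
  finally show ?thesis .
qed

section \<open>The quintic functional and the catalecticant\<close>

text \<open>
  The vector \<open>a\<^sub>0 (x\<^sup>5)\<^sup>* + \<dots> + a\<^sub>5 (y\<^sup>5)\<^sup>*\<close>, as a functional on all of \<open>F[x, y]\<close>
  that ignores the parts of degree other than 5.
\<close>

definition quintic_functional :: "(nat \<Rightarrow> 'a::field) \<Rightarrow> 'a poly poly \<Rightarrow> 'a" where
  "quintic_functional a = (\<lambda>f. \<Sum>i\<le>5. a i * dual_monom (5 - i) i f)"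

lemma quintic_functional_add:
  "quintic_functional a (f + g) = quintic_functional a f + quintic_functional a g"
  by (simp add: quintic_functional_def dual_monom_def algebra_simps sum.distrib)

lemma quintic_functional_scale: "quintic_functional a (const2 c * f) = c * quintic_functional a f"
  by (simp add: quintic_functional_def dual_monom_def const2_def algebra_simps sum_distrib_left)

lemma quadratic_form_eq: "quadratic_form s = [:[:0, 0, s $ 1:], [:0, s $ 2:], [:s $ 3:]:]"
  by (simp add: quadratic_form_def const2_def varX_def varY_def power2_eq_square)

lemma linear_form_cases:
  assumes "l \<in> binary_forms 1"
  obtains \<alpha> \<beta> where "l = const2 \<alpha> * varX + const2 \<beta> * varY"
  using linear_form_eq[OF assms] that
  by (auto simp: const2_def varX_def varY_def)

lemma quintic_functional_quadratic_square:
  "quintic_functional a (quadratic_form s ^ 2 * varX) = scalar_product s (hankel3 a 0 *v s)"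
  "quintic_functional a (quadratic_form s ^ 2 * varY) = scalar_product s (hankel3 a 1 *v s)"
  by (simp_all add: quintic_functional_def dual_monom_def quadratic_form_eq varX_def varY_def
      scalar_product_def matrix_vector_mult_def hankel3_def sum_3 power2_eq_square
      atMost_nat_numeral atMost_Suc eval_nat_numeral algebra_simps)

lemma quintic_functional_square_orthogonal_iff:
  "(\<forall>h\<in>binary_forms 1. quintic_functional a (quadratic_form s ^ 2 * h) = 0) \<longleftrightarrow>
     scalar_product s (hankel3 a 0 *v s) = 0 \<and> scalar_product s (hankel3 a 1 *v s) = 0"
  (is "?L \<longleftrightarrow> ?R")
proof
  assume ?L
  then show ?R
    unfolding quintic_functional_quadratic_square [symmetric]
    using varX_binary_form varY_binary_form by blast
next
  assume R: ?R
  show ?L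
  proof
    fix h :: "'a poly poly" assume "h \<in> binary_forms 1"
    then obtain \<alpha> \<beta> where h: "h = const2 \<alpha> * varX + const2 \<beta> * varY"
      by (rule linear_form_cases)
    have "quadratic_form s ^ 2 * h
      = const2 \<alpha> * (quadratic_form s ^ 2 * varX) + const2 \<beta> * (quadratic_form s ^ 2 * varY)"
      by (simp add: h algebra_simps)
    with R show "quintic_functional a (quadratic_form s ^ 2 * h) = 0"
      by (simp only: quintic_functional_add quintic_functional_scale
          quintic_functional_quadratic_square) simp
  qed
qed

lemma det_3_kernel_eq_0:
  fixes M :: "'a::idom ^ 3 ^ 3"
  assumes "M *v v = 0" "v \<noteq> 0"
  shows "det M = 0"
proof -
  have "M $ i $ 1 * v $ 1 + M $ i $ 2 * v $ 2 + M $ i $ 3 * v $ 3 = 0" for i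
    using arg_cong[OF assms(1), of "\<lambda>x. x $ i"] by (simp add: matrix_vector_mult_def sum_3)
  from this[of 1] this[of 2] this[of 3]
  have "det M * v $ 1 = 0" "det M * v $ 2 = 0" "det M * v $ 3 = 0"
    unfolding det_3 by algebra+
  with assms(2) show ?thesis by (auto simp: vec_eq_iff forall_3)
qed

text \<open>
  If the functional vanishes on all quintic multiples of \<open>(\<alpha> x + \<beta> y)\<^sup>2\<close>, then the nonzero
  vector \<open>(\<alpha>\<^sup>2, 2 \<alpha> \<beta>, \<beta>\<^sup>2)\<close> lies in the kernel of both Hankel matrices.
\<close>

lemma Cat22_eq_0:
  assumes l: "l \<in> binary_forms 1 - {0}"
    and zero: "\<forall>h\<in>binary_forms 3. quintic_functional a (l ^ 2 * h) = 0"
  shows "Cat22 a = 0"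
proof -
  obtain \<alpha> \<beta> where l_eq: "l = const2 \<alpha> * varX + const2 \<beta> * varY"
    using linear_form_cases l by blast
  have form: "varX ^ i * varY ^ j \<in> binary_forms 3" if "i + j = 3" for i j
    using binary_forms_mult[OF binary_forms_power[OF varX_binary_form, of i]
        binary_forms_power[OF varY_binary_form, of j]] that by simp
  have orth: "quintic_functional a (l ^ 2 * (varX ^ i * varY ^ j)) = 0" if "i + j = 3" for i j
    using zero form[OF that] by blast
  note expand = l_eq quintic_functional_def dual_monom_def varX_def varY_def const2_def
    power2_eq_square atMost_Suc numeral_eq_Suc algebra_simps
  have rec0: "\<alpha> ^ 2 * a 0 + 2 * \<alpha> * \<beta> * a 1 + \<beta> ^ 2 * a 2 = 0"
    using orth[of 3 0] by (simp add: expand)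
  have rec1: "\<alpha> ^ 2 * a 1 + 2 * \<alpha> * \<beta> * a 2 + \<beta> ^ 2 * a 3 = 0"
    using orth[of 2 1] by (simp add: expand)
  have rec2: "\<alpha> ^ 2 * a 2 + 2 * \<alpha> * \<beta> * a 3 + \<beta> ^ 2 * a 4 = 0"
    using orth[of 1 2] by (simp add: expand)
  have rec3: "\<alpha> ^ 2 * a 3 + 2 * \<alpha> * \<beta> * a 4 + \<beta> ^ 2 * a 5 = 0"
    using orth[of 0 3] by (simp add: expand)
  define s :: "'a ^ 3" where "s = vector [\<alpha> ^ 2, 2 * \<alpha> * \<beta>, \<beta> ^ 2]"
  have "hankel3 a k *v s = 0" if "k \<le> 1" for k
  proof -
    from that consider "k = 0" | "k = 1" by linarith
    then show ?thesis
      using rec0 rec1 rec2 rec3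
      by cases (simp_all add: vec_eq_iff forall_3 matrix_vector_mult_def sum_3 hankel3_def
          s_def numeral_eq_Suc mult_ac)
  qed
  then have ker: "(\<Sum>j\<in>UNIV. hankel3 a k $ i $ j * s $ j) = 0" if "k \<le> 1" for k i
    using that by (simp add: vec_eq_iff matrix_vector_mult_def)
  let ?M = "\<chi> i j. const2 (hankel3 a 1 $ i $ j) * varX - const2 (hankel3 a 0 $ i $ j) * varY"
  have const2_sum: "const2 (x + y) = const2 x + const2 y" for x y :: 'a
    by (simp add: const2_def)
  have "?M *v (\<chi> j. const2 (s $ j)) = 0"
  proof (unfold vec_eq_iff, rule allI)
    fix i
    have "(?M *v (\<chi> j. const2 (s $ j))) $ i
      = const2 (\<Sum>j\<in>UNIV. hankel3 a 1 $ i $ j * s $ j) * varX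
        - const2 (\<Sum>j\<in>UNIV. hankel3 a 0 $ i $ j * s $ j) * varY"
      by (simp add: matrix_vector_mult_def sum_3 const2_sum const2_mult algebra_simps)
    also have "\<dots> = 0" using ker[of 1] ker[of 0] by simp
    finally show "(?M *v (\<chi> j. const2 (s $ j))) $ i = 0 $ i" by simp
  qed
  moreover have "(\<chi> j. const2 (s $ j)) \<noteq> 0"
  proof
    assume "(\<chi> j. const2 (s $ j)) = 0"
    then have "\<alpha> = 0" "\<beta> = 0" by (auto simp: vec_eq_iff forall_3 s_def)
    with l l_eq show False by simp
  qed
  ultimately show ?thesis unfolding Cat22_def by (rule det_3_kernel_eq_0)
qed

section \<open>Passing to the projective plane\<close>

lemma bij_betw_quadratic_form:
  "bij_betw quadratic_form {s :: 'a::field ^ 3. s \<noteq> 0} (binary_forms 2 - {0})"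
  unfolding bij_betw_def
proof
  show "inj_on quadratic_form {s :: 'a ^ 3. s \<noteq> 0}"
    by (auto simp: inj_on_def quadratic_form_eq vec_eq_iff forall_3)
  show "quadratic_form ` {s :: 'a ^ 3. s \<noteq> 0} = binary_forms 2 - {0}"
  proof (intro equalityI subsetI)
    fix g :: "'a poly poly" assume "g \<in> quadratic_form ` {s. s \<noteq> 0}"
    then show "g \<in> binary_forms 2 - {0}"
      by (auto simp: quadratic_form_eq vec_eq_iff forall_3 coeff_pCons numeral_eq_Suc
          intro!: binary_formsI split: nat.splits)
  next
    fix g :: "'a poly poly" assume g: "g \<in> binary_forms 2 - {0}"
    define s :: "'a ^ 3" where
      "s = vector [coeff (coeff g 0) 2, coeff (coeff g 1) 1, coeff (coeff g 2) 0]"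
    have "g = quadratic_form s"
      using g by (intro poly_eqI)
        (auto simp: quadratic_form_eq s_def coeff_binary_form coeff_pCons numeral_eq_Suc
          split: nat.splits)
    moreover from this g have "s \<noteq> 0" by (auto simp: quadratic_form_eq)
    ultimately show "g \<in> quadratic_form ` {s. s \<noteq> 0}" by blast
  qed
qed

lemma quadratic_form_smult: "quadratic_form (c *s s) = const2 c * quadratic_form s"
  by (simp add: quadratic_form_eq const2_def)

lemma equiv_proportional:
  "equiv {v :: 'a::field ^ 3. v \<noteq> 0} {(u, v). u \<noteq> 0 \<and> (\<exists>c. c \<noteq> 0 \<and> v = c *s u)}"
proof (rule equivI)
  show "{(u, v). u \<noteq> 0 \<and> (\<exists>c. c \<noteq> 0 \<and> v = c *s u)} \<subseteq> {v :: 'a ^ 3. v \<noteq> 0} \<times> {v. v \<noteq> 0}"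
    by auto
  show "refl_on {v :: 'a ^ 3. v \<noteq> 0} {(u, v). u \<noteq> 0 \<and> (\<exists>c. c \<noteq> 0 \<and> v = c *s u)}"
    by (auto simp: refl_on_def intro: exI[of _ 1])
  show "sym {(u, v :: 'a ^ 3). u \<noteq> 0 \<and> (\<exists>c. c \<noteq> 0 \<and> v = c *s u)}"
  proof (rule symI)
    fix u v :: "'a ^ 3" assume "(u, v) \<in> {(u, v). u \<noteq> 0 \<and> (\<exists>c. c \<noteq> 0 \<and> v = c *s u)}"
    then obtain c where c: "u \<noteq> 0" "c \<noteq> 0" "v = c *s u" by auto
    then have "u = inverse c *s v" "v \<noteq> 0" by (simp_all add: vector_smult_assoc)
    with c(2) show "(v, u) \<in> {(u, v). u \<noteq> 0 \<and> (\<exists>c. c \<noteq> 0 \<and> v = c *s u)}"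
      by (auto intro!: exI[of _ "inverse c"])
  qed
  show "trans {(u, v :: 'a ^ 3). u \<noteq> 0 \<and> (\<exists>c. c \<noteq> 0 \<and> v = c *s u)}"
  proof (rule transI)
    fix u v w :: "'a ^ 3"
    assume "(u, v) \<in> {(u, v). u \<noteq> 0 \<and> (\<exists>c. c \<noteq> 0 \<and> v = c *s u)}"
      and "(v, w) \<in> {(u, v). u \<noteq> 0 \<and> (\<exists>c. c \<noteq> 0 \<and> v = c *s u)}"
    then obtain c d where "u \<noteq> 0" "c \<noteq> 0" "d \<noteq> 0" "w = (d * c) *s u"
      by (auto simp: vector_smult_assoc)
    then show "(u, w) \<in> {(u, v). u \<noteq> 0 \<and> (\<exists>c. c \<noteq> 0 \<and> v = c *s u)}"
      by (auto intro!: exI[of _ "d * c"])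
  qed
qed

lemma proj_planeE:
  fixes P :: "('a::field ^ 3) set"
  assumes "P \<in> proj_plane"
  obtains u where "u \<noteq> 0" "P = (\<lambda>c. c *s u) ` (UNIV - {0})"
  using assms unfolding proj_plane_def
  by (elim quotientE) (auto simp: image_iff Image_def intro!: that)

lemma epsilon_point:
  fixes P :: "('a::{field,finite} ^ 3) set"
  assumes P: "P \<in> proj_plane"
  shows "(\<Sum>s\<in>P. epsilon_form (quadratic_form s))
    = (of_nat CARD('a) - 1) * epsilon (quadratic_form ` P)"
proof -
  from P obtain u where u: "u \<noteq> 0" "P = (\<lambda>c. c *s u) ` (UNIV - {0})"
    by (rule proj_planeE)
  have g: "quadratic_form u \<in> binary_forms 2 - {0}"
    using u(1) bij_betw_imp_surj_on[OF bij_betw_quadratic_form] by blast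
  have eps: "epsilon_form (quadratic_form s) = epsilon_form (quadratic_form u)" if "s \<in> P" for s
    using that u g by (auto simp: quadratic_form_smult epsilon_form_scale)
  have "1 *s u \<in> P" unfolding u(2) by (rule imageI) simp
  then have "P \<noteq> {}" by blast
  then have "epsilon_form ` quadratic_form ` P = {epsilon_form (quadratic_form u)}"
    using eps by (auto simp: image_image)
  then have "epsilon (quadratic_form ` P) = epsilon_form (quadratic_form u)"
    by (simp add: epsilon_def)
  moreover have "inj_on (\<lambda>c. c *s u) (UNIV - {0})"
    using u(1) by (auto simp: inj_on_def vec_eq_iff)
  then have "card P = CARD('a) - 1"
    by (simp add: u(2) card_image card_Diff_singleton)
  then have "of_nat (card P) = (of_nat CARD('a) - 1 :: complex)"
    using card_field_gt_1[where 'a = 'a] by (simp add: of_nat_diff)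
  moreover have "(\<Sum>s\<in>P. epsilon_form (quadratic_form s))
      = (\<Sum>s\<in>P. epsilon_form (quadratic_form u))"
    using eps by (rule sum.cong[OF refl])
  ultimately show ?thesis by simp
qed

lemma scalar_product_smult:
  "scalar_product (c *s s) (M *v (c *s s)) = c ^ 2 * scalar_product s (M *v s)"
  for s :: "'a::field ^ 3"
  by (simp add: scalar_product_def matrix_vector_mult_def sum_3 power2_eq_square algebra_simps)

text \<open>
  Every point of the plane is a set of \<open>q - 1\<close> vectors, on which \<open>\<epsilon>\<close> and the two equations are
  constant. In terms of forms, the equations say that the functional vanishes on the quintic
  multiples of \<open>g\<^sup>2\<close>.
\<close>

lemma C_coeff_eq:
  fixes a :: "nat \<Rightarrow> 'a::{field,finite}"
  shows "(of_nat CARD('a) - 1) * C_coeff a =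
    - (\<Sum>g | g \<in> binary_forms 2 - {0} \<and>
          (\<forall>h\<in>binary_forms 1. quintic_functional a (g ^ 2 * h) = 0). epsilon_form g)"
proof -
  define Z where "Z = (\<lambda>s :: 'a ^ 3. scalar_product s (hankel3 a 0 *v s) = 0
    \<and> scalar_product s (hankel3 a 1 *v s) = 0)"
  define \<P> where "\<P> = {P \<in> proj_plane. \<forall>s\<in>P. Z s}"
  have Z_class: "\<forall>s\<in>P. Z s" if "P \<in> proj_plane" "u \<in> P" "Z u" for P u
  proof -
    from that(1) obtain v where v: "P = (\<lambda>c. c *s v) ` (UNIV - {0})" by (rule proj_planeE)
    with that(2,3) have "Z v" by (auto simp: Z_def scalar_product_smult)
    with v show ?thesis by (auto simp: Z_def scalar_product_smult)
  qed
  have Un: "\<Union>proj_plane = {s :: 'a ^ 3. s \<noteq> 0}"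
    unfolding proj_plane_def by (rule Union_quotient[OF equiv_proportional])
  have union: "\<Union>\<P> = {s. s \<noteq> 0 \<and> Z s}"
  proof (intro equalityI subsetI)
    fix s assume "s \<in> \<Union>\<P>"
    then show "s \<in> {s. s \<noteq> 0 \<and> Z s}" using Un by (auto simp: \<P>_def)
  next
    fix s assume s: "s \<in> {s. s \<noteq> 0 \<and> Z s}"
    then obtain P where "P \<in> proj_plane" "s \<in> P" using Un by blast
    with s Z_class show "s \<in> \<Union>\<P>" by (auto simp: \<P>_def)
  qed
  have disj: "\<forall>P\<in>\<P>. \<forall>P'\<in>\<P>. P \<noteq> P' \<longrightarrow> P \<inter> P' = {}"
    using quotient_disj[OF equiv_proportional] unfolding \<P>_def proj_plane_def by blast
  have "(of_nat CARD('a) - 1) * C_coeff a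
      = - (\<Sum>P\<in>\<P>. (of_nat CARD('a) - 1) * epsilon (quadratic_form ` P))"
    by (simp add: C_coeff_def \<P>_def Z_def sum_distrib_left)
  also have "(\<Sum>P\<in>\<P>. (of_nat CARD('a) - 1) * epsilon (quadratic_form ` P))
      = (\<Sum>P\<in>\<P>. \<Sum>s\<in>P. epsilon_form (quadratic_form s))"
    by (intro sum.cong refl) (simp add: \<P>_def epsilon_point)
  also have "\<dots> = (\<Sum>s | s \<noteq> 0 \<and> Z s. epsilon_form (quadratic_form s))"
    using sum.Union_disjoint[of \<P> "\<lambda>s. epsilon_form (quadratic_form s)"] disj
    by (simp add: union)
  also have "\<dots> = (\<Sum>g | g \<in> binary_forms 2 - {0} \<and>
          (\<forall>h\<in>binary_forms 1. quintic_functional a (g ^ 2 * h) = 0). epsilon_form g)"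
  proof (rule sum.reindex_bij_betw)
    have Z: "Z s \<longleftrightarrow> (\<forall>h\<in>binary_forms 1. quintic_functional a (quadratic_form s ^ 2 * h) = 0)" for s
      unfolding Z_def by (rule quintic_functional_square_orthogonal_iff[symmetric])
    have surj: "quadratic_form ` {s :: 'a ^ 3. s \<noteq> 0} = binary_forms 2 - {0}"
      using bij_betw_quadratic_form by (rule bij_betw_imp_surj_on)
    show "bij_betw quadratic_form {s. s \<noteq> 0 \<and> Z s} {g. g \<in> binary_forms 2 - {0} \<and>
          (\<forall>h\<in>binary_forms 1. quintic_functional a (g ^ 2 * h) = 0)}"
      unfolding Z surj[symmetric]
      by (rule bij_betw_imageI)
        (use bij_betw_imp_inj_on[OF bij_betw_quadratic_form[where 'a = 'a]] in
          \<open>auto intro: inj_on_subset\<close>)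
  qed
  finally show ?thesis .
qed

section \<open>Evaluation of the exponential sum\<close>

lemma sum_filter_of_bool:
  fixes e :: "'b \<Rightarrow> 'c::semiring_1"
  assumes "finite A"
  shows "(\<Sum>x | x \<in> A \<and> P x. e x) = (\<Sum>x\<in>A. of_bool (P x) * e x)"
  using assms by (simp add: sum.inter_filter of_bool_def if_distrib[of "\<lambda>x. x * _"] cong: if_cong)

theorem theorem1p1:
  fixes \<psi> :: "'a::{field,finite} \<Rightarrow> complex"
    and a :: "nat \<Rightarrow> 'a"
    and w :: "'a poly poly \<Rightarrow> 'a"
  assumes "nontrivial_additive_character \<psi>"
    and "w = (\<lambda>f. \<Sum>i\<le>5. a i * dual_monom (5 - i) i f)"
    and "Cat22 a \<noteq> 0"
  shows "Phi_hat \<psi> w = C_coeff a / of_nat CARD('a) ^ 4"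
proof -
  let ?L = "binary_forms 1 - {0 :: 'a poly poly}" and ?G = "binary_forms 2 - {0 :: 'a poly poly}"
    and ?F = "binary_forms 5 :: 'a poly poly set"
  define Q :: complex where "Q = of_nat CARD('a)"
  have Q: "Q \<noteq> 0" "Q - 1 \<noteq> 0" using card_field_gt_1[where 'a = 'a] by (auto simp: Q_def)
  have w: "w = quintic_functional a" by (simp add: assms(2) quintic_functional_def)
  note w_linear = quintic_functional_add[of a, folded w] quintic_functional_scale[of a, folded w]
  note multiples = character_sum_multiples[OF assms(1) w_linear]
  have linear: "(\<Sum>f | f \<in> ?F \<and> l ^ 2 dvd f. \<psi> (w f)) = 0" if "l \<in> ?L" for l
    using multiples[of "l ^ 2" 2 3] that binary_forms_power[of l 1 2] Cat22_eq_0[of l a] assms(3)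
    by (auto simp: w)
  have quadratic: "(\<Sum>f | f \<in> ?F \<and> g ^ 2 dvd f. \<psi> (w f)) =
      Q ^ 2 * of_bool (\<forall>h\<in>binary_forms 1. w (g ^ 2 * h) = 0)" if "g \<in> ?G" for g
    using multiples[of "g ^ 2" 4 1] that binary_forms_power[of g 2 2]
    by (simp add: Q_def power2_eq_square)
  have restrict: "(\<Sum>f\<in>?F. \<psi> (w f) * of_bool (P f)) = (\<Sum>f | f \<in> ?F \<and> P f. \<psi> (w f))" for P
    by (simp add: sum_filter_of_bool mult.commute)
  have "(Q - 1) * (\<Sum>f | f \<in> ?F \<and> singular_form f. \<psi> (w f))
      = (\<Sum>f\<in>?F. \<psi> (w f) * ((Q - 1) * of_bool (singular_form f)))"
    unfolding restrict [symmetric] sum_distrib_left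
    by (intro sum.cong refl) (simp only: mult_ac)
  also have "\<dots> = (\<Sum>f\<in>?F. \<psi> (w f) *
      ((\<Sum>l\<in>?L. of_bool (l ^ 2 dvd f)) - (\<Sum>g\<in>?G. of_bool (g ^ 2 dvd f) * epsilon_form g)))"
  proof (intro sum.cong refl)
    fix f assume f: "f \<in> ?F"
    have "of_nat (card {l \<in> ?L. l ^ 2 dvd f}) = (\<Sum>l\<in>?L. of_bool (l ^ 2 dvd f) :: complex)"
      by (simp add: sum_of_bool_eq Int_def)
    moreover have "(\<Sum>g | g \<in> ?G \<and> g ^ 2 dvd f. epsilon_form g)
        = (\<Sum>g\<in>?G. of_bool (g ^ 2 dvd f) * epsilon_form g)"
      by (rule sum_filter_of_bool) simp
    ultimately show "\<psi> (w f) * ((Q - 1) * of_bool (singular_form f)) = \<psi> (w f) *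
      ((\<Sum>l\<in>?L. of_bool (l ^ 2 dvd f)) - (\<Sum>g\<in>?G. of_bool (g ^ 2 dvd f) * epsilon_form g))"
      using singular_form_indicator[OF f] by (simp only: Q_def)
  qed
  also have "\<dots> = (\<Sum>l\<in>?L. \<Sum>f\<in>?F. \<psi> (w f) * of_bool (l ^ 2 dvd f))
      - (\<Sum>g\<in>?G. epsilon_form g * (\<Sum>f\<in>?F. \<psi> (w f) * of_bool (g ^ 2 dvd f)))"
    unfolding right_diff_distrib sum_subtractf sum_distrib_left
    by (subst (1 2) sum.swap) (simp add: mult_ac)
  also have "\<dots> = - (\<Sum>g\<in>?G. epsilon_form g *
      (Q ^ 2 * of_bool (\<forall>h\<in>binary_forms 1. w (g ^ 2 * h) = 0)))"
    by (simp only: restrict linear quadratic cong: sum.cong) simp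
  also have "\<dots> = - (Q ^ 2 *
      (\<Sum>g | g \<in> ?G \<and> (\<forall>h\<in>binary_forms 1. w (g ^ 2 * h) = 0). epsilon_form g))"
    unfolding sum_filter_of_bool[OF finite_Diff[OF finite_binary_forms]] sum_distrib_left
    by (simp only: mult_ac)
  also have "\<dots> = (Q - 1) * (Q ^ 2 * C_coeff a)"
    by (simp only: w Q_def mult.left_commute[of "_ - 1"] C_coeff_eq mult_minus_right)
  finally have "(\<Sum>f | f \<in> ?F \<and> singular_form f. \<psi> (w f)) = Q ^ 2 * C_coeff a"
    using Q by simp
  then have "Phi_hat \<psi> w = Q ^ 2 * C_coeff a / Q ^ 6"
    by (simp add: Phi_hat_def card_binary_forms Q_def)
  also have "\<dots> = C_coeff a / Q ^ 4"
    using Q by (simp add: field_simps flip: power_add)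
  finally show ?thesis by (simp add: Q_def)
qed

end
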